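(* Let $G=(V,E)$ be a finite, simple, connected regular graph on $n\geq 2$ vertices and let $\lambda_{\min}$ be the least eigenvalue of its Laplacian $L$. Let $W\subset V$ be a stable set for which the Hoffman bound is sharp, i.e. $$\frac{|W|}{n}=\frac{-\lambda_{\min}-1}{-\lambda_{\min}}.$$ Then $W$ does not integrate the eigenspace of $L$ with eigenvalue $\lambda_{\min}$.
   Context: $L=AD^{-1}-I$, where $A$ is the adjacency matrix of $G$ and $D$ its diagonal degree matrix. A nonempty $W\subset V$ integrates a function $\phi:V\to\mathbb{R}$ if $\frac{1}{|W|}\sum_{w\in W}\phi(w)=\frac{1}{|V|}\sum_{v\in V}\phi(v)$, and integrates an eigenspace of $L$ if it integrates every eigenvector in a basis of it. The Hoffman bound states that every stable (independent) set $W$ in a regular graph satisfies $|W|/n\le\frac{-\lambda_{\min}-1}{-\lambda_{\min}}$. *)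

theory Defs
  imports "HOL-Analysis.Analysis" "Graph_Theory.Graph_Theory"
begin

text \<open>
  A finite simple graph is a \<open>pair_graph\<close>: finite, loop-free, with a symmetric set of arcs given as
  pairs of vertices. The vertex set is a whole finite type \<open>'v\<close> (\<open>pverts G = UNIV\<close>), so that
  functions on the vertices are elements of \<open>real ^ 'v\<close> and operators on them are matrices.
\<close>

definition regular_graph :: "'v pair_pre_digraph \<Rightarrow> bool" where
  "regular_graph G \<longleftrightarrow> (\<exists>d. \<forall>v \<in> pverts G. out_degree (with_proj G) v = d)"

definition stable_set :: "'v pair_pre_digraph \<Rightarrow> 'v set \<Rightarrow> bool" where
  "stable_set G W \<longleftrightarrow> W \<subseteq> pverts G \<and> (\<forall>u \<in> W. \<forall>v \<in> W. (u, v) \<notin> parcs G)"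

definition adjacency_matrix :: "'v::finite pair_pre_digraph \<Rightarrow> real ^ 'v ^ 'v" where
  "adjacency_matrix G = (\<chi> u v. if (u, v) \<in> parcs G then 1 else 0)"

definition degree_matrix :: "'v::finite pair_pre_digraph \<Rightarrow> real ^ 'v ^ 'v" where
  "degree_matrix G = (\<chi> u v. if u = v then real (out_degree (with_proj G) u) else 0)"

text \<open>
  With this sign convention the eigenvalues lie in \<open>[-2, 0]\<close>. The inverse is meaningful only if
  no vertex is isolated, which holds for connected graphs with at least two vertices.
\<close>

definition laplacian :: "'v::finite pair_pre_digraph \<Rightarrow> real ^ 'v ^ 'v" where
  "laplacian G = adjacency_matrix G ** matrix_inv (degree_matrix G) - mat 1"

definition eigenspace :: "real ^ 'v ^ 'v \<Rightarrow> real \<Rightarrow> (real ^ 'v::finite) set" where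
  "eigenspace L \<mu> = {\<phi>. L *v \<phi> = \<mu> *\<^sub>R \<phi>}"

definition eigenvalue :: "real ^ 'v ^ 'v::finite \<Rightarrow> real \<Rightarrow> bool" where
  "eigenvalue L \<mu> \<longleftrightarrow> (\<exists>\<phi>. \<phi> \<noteq> 0 \<and> L *v \<phi> = \<mu> *\<^sub>R \<phi>)"

definition least_eigenvalue :: "real ^ 'v ^ 'v::finite \<Rightarrow> real \<Rightarrow> bool" where
  "least_eigenvalue L \<mu> \<longleftrightarrow> eigenvalue L \<mu> \<and> (\<forall>\<nu>. eigenvalue L \<nu> \<longrightarrow> \<mu> \<le> \<nu>)"

definition integrates :: "'v::finite set \<Rightarrow> real ^ 'v \<Rightarrow> bool" where
  "integrates W \<phi> \<longleftrightarrow> W \<noteq> {} \<and>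
     (\<Sum>w\<in>W. \<phi> $ w) / real (card W) = (\<Sum>v\<in>UNIV. \<phi> $ v) / real CARD('v)"

definition integrates_space :: "'v::finite set \<Rightarrow> (real ^ 'v) set \<Rightarrow> bool" where
  "integrates_space W S \<longleftrightarrow>
     W \<noteq> {} \<and> (\<exists>B \<subseteq> S. independent B \<and> span B = S \<and> (\<forall>\<phi> \<in> B. integrates W \<phi>))"

end

theory Submission
  imports Defs
begin

text \<open>
  The proof is the equality case of the variational proof of the Hoffman bound. Let \<open>n\<close> be the
  number of vertices and \<open>f\<close> the indicator function of \<open>W\<close> minus its mean \<open>|W| / n\<close>. If \<open>W\<close>
  integrates a function \<open>\<phi>\<close>, then \<open>f \<bullet> \<phi> = 0\<close> (\<open>integrates_imp_orthogonal\<close>), and by linearity this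
  passes from a basis to the whole eigenspace.

  In a regular graph \<open>L\<close> is self-adjoint and annihilates the constants, and stability of \<open>W\<close> gives
  \<open>f \<bullet> L f = -|W|\<close>, whereas \<open>f \<bullet> f = |W| (1 - |W| / n)\<close>. The Rayleigh principle
  \<open>lam (f \<bullet> f) \<le> f \<bullet> L f\<close> thus is the Hoffman bound for nonempty \<open>W\<close>, and it is sharp exactly
  when \<open>f\<close> attains the minimum of the Rayleigh quotient. A function attaining this minimum lies in the
  eigenspace of \<open>lam\<close> (\<open>rayleigh_equality_imp_eigenvector\<close>). Were the eigenspace integrated by \<open>W\<close>,
  then \<open>f\<close> would be orthogonal to itself, which is absurd as \<open>f \<bullet> f = -|W| / lam\<close> is not zero.
\<close>

section \<open>The Rayleigh principle for self-adjoint operators\<close>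

text \<open>
  Perturb \<open>f\<close> in the direction of \<open>- T f\<close>: the form has the negative slope
  \<open>-2 (T f \<bullet> T f)\<close> there, so a small step would make it negative unless \<open>T f = 0\<close>.
\<close>

lemma psd_form_zero_imp_kernel:
  fixes T :: "'a::real_inner \<Rightarrow> 'a"
  assumes lin: "linear T" and sym: "\<And>x y. x \<bullet> T y = T x \<bullet> y"
    and psd: "\<And>x. 0 \<le> x \<bullet> T x" and zero: "f \<bullet> T f = 0"
  shows "T f = 0"
proof (rule ccontr)
  assume "T f \<noteq> 0"
  define g where "g = T f"
  define b where "b = g \<bullet> g"
  define c where "c = g \<bullet> T g"
  \<comment> \<open>Along \<open>f - s *\<^sub>R g\<close> the form is \<open>s * (s * c - 2 * b)\<close>; the step below keeps \<open>s * c \<le> b\<close>, and the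
     \<open>+ 1\<close> covers the case \<open>c = 0\<close>.\<close>
  define s where "s = b / (c + 1)"
  have b: "0 < b" using \<open>T f \<noteq> 0\<close> by (simp add: b_def g_def)
  have c: "0 \<le> c" using psd by (simp add: c_def)
  have s: "0 < s" using b c by (simp add: s_def)
  have fg: "f \<bullet> T g = b" by (simp add: sym b_def g_def)
  have gf: "g \<bullet> T f = b" by (simp add: b_def g_def)
  have "(f - s *\<^sub>R g) \<bullet> T (f - s *\<^sub>R g)
      = (f - s *\<^sub>R g) \<bullet> (T f - s *\<^sub>R T g)"
    by (simp only: linear_diff[OF lin] linear_cmul[OF lin])
  also have "\<dots> = s * (s * c - 2 * b)"
    unfolding inner_diff_left inner_diff_right inner_scaleR_left inner_scaleR_right zero fg gf
      c_def[symmetric]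
    by (simp add: algebra_simps)
  finally have "0 \<le> s * (s * c - 2 * b)" using psd[of "f - s *\<^sub>R g"] by simp
  then have "2 * b \<le> s * c" using s by (simp add: zero_le_mult_iff)
  moreover have "s * c \<le> b"
    using b c by (simp add: s_def field_simps)
  ultimately show False using b by simp
qed

text \<open>
  The minimum is attained on the unit sphere by compactness. Subtracting the minimal value leaves a
  positive semidefinite form that vanishes at the minimiser, which is therefore an eigenvector.
\<close>

lemma rayleigh_minimum_is_eigenvalue:
  fixes T :: "'a::euclidean_space \<Rightarrow> 'a"
  assumes lin: "linear T" and sym: "\<And>x y. x \<bullet> T y = T x \<bullet> y"
  obtains m x0 where "x0 \<noteq> 0" "T x0 = m *\<^sub>R x0" "\<And>x. m * (x \<bullet> x) \<le> x \<bullet> T x"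
proof -
  let ?S = "sphere (0::'a) 1"
  have "continuous_on ?S (\<lambda>x. x \<bullet> T x)"
    by (intro continuous_intros linear_continuous_on linear_conv_bounded_linear[THEN iffD1] lin)
  then have "\<exists>x\<in>?S. \<forall>y\<in>?S. x \<bullet> T x \<le> y \<bullet> T y"
    by (intro continuous_attains_inf) simp_all
  then obtain x0 where x0: "x0 \<in> ?S" and min: "\<And>y. y \<in> ?S \<Longrightarrow> x0 \<bullet> T x0 \<le> y \<bullet> T y"
    by blast
  define m where "m = x0 \<bullet> T x0"
  have bound: "m * (x \<bullet> x) \<le> x \<bullet> T x" for x
  proof (cases "x = 0")
    case False
    let ?u = "x /\<^sub>R norm x"
    have "m \<le> ?u \<bullet> T ?u" using min[of ?u] False by (simp add: m_def)
    also have "\<dots> = (x \<bullet> T x) / (x \<bullet> x)"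
      by (simp add: linear_cmul[OF lin] dot_square_norm power2_eq_square field_simps)
    finally show ?thesis using False by (simp add: pos_le_divide_eq)
  qed simp
  have "T x0 - m *\<^sub>R x0 = 0"
  proof (rule psd_form_zero_imp_kernel[of "\<lambda>x. T x - m *\<^sub>R x"])
    show "linear (\<lambda>x. T x - m *\<^sub>R x)"
      by (intro linear_compose_sub lin linear_scale_self)
    show "x \<bullet> (T y - m *\<^sub>R y) = (T x - m *\<^sub>R x) \<bullet> y" for x y
      by (simp add: inner_diff_left inner_diff_right sym)
    show "0 \<le> x \<bullet> (T x - m *\<^sub>R x)" for x
      using bound by (simp add: inner_diff_right)
    show "x0 \<bullet> (T x0 - m *\<^sub>R x0) = 0"
      using x0 by (simp add: inner_diff_right m_def dot_square_norm)
  qed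
  then have "T x0 = m *\<^sub>R x0" by simp
  moreover have "x0 \<noteq> 0" using x0 by auto
  ultimately show thesis using bound by (intro that)
qed

lemma rayleigh_equality_imp_eigenvector:
  fixes L :: "real ^ 'v ^ 'v::finite"
  assumes sym: "transpose L = L" and least: "least_eigenvalue L lam"
    and eq: "f \<bullet> (L *v f) = lam * (f \<bullet> f)"
  shows "f \<in> eigenspace L lam"
proof -
  have symL: "x \<bullet> (L *v y) = (L *v x) \<bullet> y" for x y
    by (metis dot_lmul_matrix vector_transpose_matrix sym)
  obtain m x0 where x0: "x0 \<noteq> 0" "L *v x0 = m *\<^sub>R x0"
    and bound: "\<And>x. m * (x \<bullet> x) \<le> x \<bullet> (L *v x)"
    using rayleigh_minimum_is_eigenvalue[OF matrix_vector_mul_linear symL] by metis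
  have "lam \<le> m" using least x0 by (auto simp: least_eigenvalue_def eigenvalue_def)
  have "L *v f - lam *\<^sub>R f = 0"
  proof (rule psd_form_zero_imp_kernel[of "\<lambda>x. L *v x - lam *\<^sub>R x"])
    show "linear (\<lambda>x. L *v x - lam *\<^sub>R x)"
      by (intro linear_compose_sub matrix_vector_mul_linear linear_scale_self)
    show "x \<bullet> (L *v y - lam *\<^sub>R y) = (L *v x - lam *\<^sub>R x) \<bullet> y" for x y
      by (simp add: inner_diff_left inner_diff_right symL)
    show "0 \<le> x \<bullet> (L *v x - lam *\<^sub>R x)" for x
      using bound[of x] mult_right_mono[OF \<open>lam \<le> m\<close> inner_ge_zero[of x]]
      by (simp add: inner_diff_right)
    show "f \<bullet> (L *v f - lam *\<^sub>R f) = 0"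
      using eq by (simp add: inner_diff_right)
  qed
  then show ?thesis by (simp add: eigenspace_def)
qed

section \<open>The Laplacian of a regular graph\<close>

lemma out_degree_with_proj:
  "out_degree (with_proj G) v = card {u. (v, u) \<in> parcs G}"
proof -
  have "out_arcs (with_proj G) v = Pair v ` {u. (v, u) \<in> parcs G}"
    by (auto simp: out_arcs_def)
  then show ?thesis by (simp add: out_degree_def card_image inj_on_def)
qed

text \<open>
  Positivity of the degree is what connectedness contributes: it makes the degree matrix
  invertible.
\<close>

lemma connected_imp_out_degree_pos:
  fixes G :: "'v::finite pair_pre_digraph"
  assumes V: "pverts G = UNIV" and conn: "Digraph_Component.connected (with_proj G)"
    and card: "CARD('v) \<ge> 2" and deg: "\<And>v. out_degree (with_proj G) v = d"
  shows "0 < d"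
proof (rule ccontr)
  assume "\<not> 0 < d"
  then have "parcs G = {}" using deg by (auto simp: out_degree_with_proj)
  then have no_arcs: "parcs (mk_symmetric (with_proj G)) = {}" by (simp add: parcs_mk_symmetric)
  have "card {undefined :: 'v} < CARD('v)" using card by simp
  then have "{undefined :: 'v} \<noteq> UNIV" by force
  then obtain u v :: 'v where "u \<noteq> v" by auto
  have "u \<rightarrow>\<^sup>*\<^bsub>with_proj (mk_symmetric (with_proj G))\<^esub> v"
    using conn V by (simp add: connected_def strongly_connected_def)
  then show False using \<open>u \<noteq> v\<close> no_arcs
    by (auto simp: reachable_def elim: rtrancl_on.cases)
qed

lemma matrix_inv_scalar:
  fixes c :: real
  assumes "c \<noteq> 0"
  shows "matrix_inv (c *\<^sub>R mat 1 :: real ^ 'v ^ 'v::finite) = (1 / c) *\<^sub>R mat 1"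
proof -
  let ?D = "c *\<^sub>R mat 1 :: real ^ 'v ^ 'v"
  have "?D ** ((1 / c) *\<^sub>R mat 1) = mat 1" "((1 / c) *\<^sub>R mat 1) ** ?D = mat 1"
    using assms by (simp_all add: scalar_matrix_assoc[symmetric] matrix_scalar_ac)
  then have "\<exists>X. ?D ** X = mat 1 \<and> X ** ?D = mat 1" by blast
  then have "?D ** matrix_inv ?D = mat 1 \<and> matrix_inv ?D ** ?D = mat 1"
    unfolding matrix_inv_def by (rule someI_ex)
  then have "c *\<^sub>R matrix_inv ?D = mat 1" by (simp add: scalar_matrix_assoc[symmetric])
  then have "(1 / c) *\<^sub>R (c *\<^sub>R matrix_inv ?D) = (1 / c) *\<^sub>R mat 1" by simp
  then show ?thesis using assms by simp
qed

lemma laplacian_regular: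
  fixes G :: "'v::finite pair_pre_digraph"
  assumes "\<And>v. out_degree (with_proj G) v = d" and "0 < d"
  shows "laplacian G = (1 / real d) *\<^sub>R adjacency_matrix G - mat 1"
proof -
  have "degree_matrix G = real d *\<^sub>R mat 1"
    using assms(1) by (simp add: degree_matrix_def mat_def vec_eq_iff)
  then show ?thesis
    using assms(2) by (simp add: laplacian_def matrix_inv_scalar matrix_scalar_ac)
qed

lemma transpose_laplacian_regular:
  fixes G :: "'v::finite pair_pre_digraph"
  assumes "pair_graph G" and "\<And>v. out_degree (with_proj G) v = d" and "0 < d"
  shows "transpose (laplacian G) = laplacian G"
proof -
  interpret pair_graph G by fact
  have "(u, v) \<in> parcs G \<longleftrightarrow> (v, u) \<in> parcs G" for u v
    using arcs_symmetric by blast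
  then show ?thesis
    by (simp add: laplacian_regular[OF assms(2,3)] transpose_def adjacency_matrix_def mat_def
        vec_eq_iff)
qed

lemma laplacian_constant:
  fixes G :: "'v::finite pair_pre_digraph"
  assumes "\<And>v. out_degree (with_proj G) v = d" and "0 < d"
  shows "laplacian G *v 1 = 0"
proof -
  have "(adjacency_matrix G *v 1) $ v = real d" for v
    using assms(1)[of v]
    by (simp add: adjacency_matrix_def matrix_vector_mult_def out_degree_with_proj sum.If_cases)
  then show ?thesis
    using assms(2)
    by (simp add: laplacian_regular[OF assms] matrix_vector_mult_diff_rdistrib
        scaleR_matrix_vector_assoc[symmetric] vec_eq_iff)
qed

section \<open>Stable sets and integration\<close>

definition indicator_vec :: "'v::finite set \<Rightarrow> real ^ 'v" where
  "indicator_vec W = (\<chi> v. if v \<in> W then 1 else 0)"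

definition centred_indicator :: "'v::finite set \<Rightarrow> real ^ 'v" where
  "centred_indicator W = indicator_vec W - (real (card W) / real CARD('v)) *\<^sub>R 1"

lemma inner_indicator_vec: "indicator_vec W \<bullet> x = (\<Sum>v\<in>W. x $ v)"
proof -
  have "indicator_vec W \<bullet> x = (\<Sum>v\<in>UNIV. if v \<in> W then x $ v else 0)"
    unfolding indicator_vec_def inner_vec_def by (intro sum.cong) auto
  then show ?thesis by (simp add: sum.If_cases)
qed

lemma inner_one_vec: "(1 :: real ^ 'v::finite) \<bullet> x = (\<Sum>v\<in>UNIV. x $ v)"
  by (simp add: inner_vec_def)

lemma integrates_imp_orthogonal:
  fixes W :: "'v::finite set"
  assumes "integrates W \<phi>"
  shows "centred_indicator W \<bullet> \<phi> = 0"
proof -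
  have "W \<noteq> {}"
    and "(\<Sum>w\<in>W. \<phi> $ w) / real (card W) = (\<Sum>v\<in>UNIV. \<phi> $ v) / real CARD('v)"
    using assms by (simp_all add: integrates_def)
  then have "(\<Sum>w\<in>W. \<phi> $ w) = (\<Sum>v\<in>UNIV. \<phi> $ v) / real CARD('v) * real (card W)"
    by (simp add: nonzero_divide_eq_eq)
  then show ?thesis
    by (simp add: centred_indicator_def inner_diff_left inner_indicator_vec inner_one_vec)
qed

lemma integrates_space_imp_orthogonal:
  assumes "integrates_space W S" and "\<phi> \<in> S"
  shows "centred_indicator W \<bullet> \<phi> = 0"
proof -
  obtain B where B: "span B = S" "\<And>b. b \<in> B \<Longrightarrow> integrates W b"
    using assms(1) unfolding integrates_space_def by blast
  have "linear (\<lambda>x. centred_indicator W \<bullet> x)"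
    by (intro bounded_linear.linear bounded_linear_inner_right)
  from linear_eq_0_on_span[OF this, of B \<phi>] show ?thesis
    using B assms(2) integrates_imp_orthogonal by blast
qed

lemma centred_indicator_inner_self:
  fixes W :: "'v::finite set"
  shows "centred_indicator W \<bullet> centred_indicator W
    = real (card W) * (1 - real (card W) / real CARD('v))"
proof -
  have "indicator_vec W \<bullet> indicator_vec W = real (card W)"
    by (simp add: inner_indicator_vec) (simp add: indicator_vec_def)
  moreover have "indicator_vec W \<bullet> 1 = real (card W)"
    by (simp add: inner_indicator_vec)
  moreover have "(1 :: real ^ 'v) \<bullet> 1 = real CARD('v)"
    by (simp add: inner_one_vec)
  ultimately show ?thesis
    by (simp add: centred_indicator_def inner_diff_left inner_diff_right
        inner_commute[of 1 "indicator_vec W"] field_simps)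
qed

text \<open>
  Subtracting a constant does not affect the form, since \<open>L\<close> is symmetric and annihilates
  constants; and on the indicator function the adjacency part counts the arcs inside \<open>W\<close>, of which
  there are none. Only the term \<open>-I\<close> of \<open>L\<close> remains.
\<close>

lemma stable_set_laplacian_form:
  fixes G :: "'v::finite pair_pre_digraph"
  assumes G: "pair_graph G" and deg: "\<And>v. out_degree (with_proj G) v = d" and d: "0 < d"
    and W: "stable_set G W"
  shows "centred_indicator W \<bullet> (laplacian G *v centred_indicator W) = - real (card W)"
proof -
  let ?L = "laplacian G" and ?w = "indicator_vec W"
  have L1: "?L *v 1 = 0" using laplacian_constant[OF deg d] .
  have "1 \<bullet> (?L *v ?w) = (?L *v 1) \<bullet> ?w"
    by (metis dot_lmul_matrix vector_transpose_matrix transpose_laplacian_regular[OF G deg d])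
  then have "1 \<bullet> (?L *v ?w) = 0" using L1 by simp
  moreover have "?L *v centred_indicator W = ?L *v ?w"
    by (simp add: centred_indicator_def matrix_vector_mult_diff_distrib matrix_vector_mult_scaleR L1)
  ultimately have "centred_indicator W \<bullet> (?L *v centred_indicator W) = ?w \<bullet> (?L *v ?w)"
    by (simp add: centred_indicator_def inner_diff_left)
  moreover have "(adjacency_matrix G *v ?w) $ v = 0" if "v \<in> W" for v
    using W that unfolding stable_set_def adjacency_matrix_def indicator_vec_def
    by (auto simp: matrix_vector_mult_def intro!: sum.neutral)
  then have "(?L *v ?w) $ v = - 1" if "v \<in> W" for v
    using that
    by (simp add: laplacian_regular[OF deg d] matrix_vector_mult_diff_rdistrib
        scaleR_matrix_vector_assoc[symmetric]) (simp add: indicator_vec_def)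
  ultimately show ?thesis by (simp add: inner_indicator_vec)
qed

theorem theorem5p6:
  fixes G :: "'v::finite pair_pre_digraph" and W :: "'v set" and lam :: real
  assumes "pair_graph G" and "pverts G = UNIV"
    and "Digraph_Component.connected (with_proj G)"
    and "regular_graph G"
    and "CARD('v) \<ge> 2"
    and "least_eigenvalue (laplacian G) lam"
    and "stable_set G W"
    and "real (card W) / real CARD('v) = (- lam - 1) / (- lam)"
  shows "\<not> integrates_space W (eigenspace (laplacian G) lam)"
proof
  assume int: "integrates_space W (eigenspace (laplacian G) lam)"
  obtain d where deg: "\<And>v. out_degree (with_proj G) v = d"
    using assms(2,4) by (auto simp: regular_graph_def)
  have d: "0 < d" using connected_imp_out_degree_pos[OF assms(2,3,5) deg] .
  let ?f = "centred_indicator W"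
  have W: "0 < card W" using int by (simp add: integrates_space_def card_gt_0_iff)
  then have "real (card W) / real CARD('v) \<noteq> 0" by auto
  \<comment> \<open>\<open>lam = 0\<close> would turn the right-hand side of the sharpness hypothesis into \<open>0\<close>,
     the value of a quotient by zero.\<close>
  with assms(8) have "lam \<noteq> 0" by auto
  then have ff: "?f \<bullet> ?f = - real (card W) / lam"
    unfolding centred_indicator_inner_self assms(8) by (simp add: field_simps)
  then have "?f \<bullet> (laplacian G *v ?f) = lam * (?f \<bullet> ?f)"
    using \<open>lam \<noteq> 0\<close> by (simp add: stable_set_laplacian_form[OF assms(1) deg d assms(7)])
  then have "?f \<in> eigenspace (laplacian G) lam"
    by (rule rayleigh_equality_imp_eigenvector
        [OF transpose_laplacian_regular[OF assms(1) deg d] assms(6)])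
  then have "?f \<bullet> ?f = 0" by (rule integrates_space_imp_orthogonal[OF int])
  then show False using ff W \<open>lam \<noteq> 0\<close> by simp
qed

end
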